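(* Let $(E,p,V)$ and $(F,q,W)$ be lattice-normed spaces and let $T:E\to F$ be a linear operator. If $T$ is $rp$-compact, then $T$ is $p$-bounded.
   Context: All vector spaces are real and the vector lattices in which vector norms take values are Archimedean. A lattice-normed space $(E,p,V)$ consists of a vector space $E$, an Archimedean vector lattice $V$, and a map $p:E\to V$ (a vector norm) such that for all $x,x_1,x_2\in E$ and $\lambda\in\mathbb{R}$: $p(x)\ge 0$; $p(x)=0$ if and only if $x=0$; $p(x_1+x_2)\le p(x_1)+p(x_2)$; $p(\lambda x)=|\lambda|\,p(x)$. A subset $M\subset E$ is $p$-bounded if there is $e\in V_+$ with $p(M)\subset[-e,e]$ (i.e. $p(x)\le e$ for all $x\in M$). A net is $p$-bounded if its set of terms is $p$-bounded. A net $(x_\alpha)$ in $E$ is relatively uniformly $p$-convergent ($rp$-convergent) to $x\in E$ if there is $e\in V_+$ such that for every real $\varepsilon>0$ there is an index $\alpha_\varepsilon$ with $p(x_\alpha-x)\le\varepsilon e$ for all $\alpha\ge\alpha_\varepsilon$. A subnet of a net $(x_\alpha)_{\alpha\in\Delta}$ is a net $(x_{\varphi(\beta)})_{\beta\in B}$, where $B$ is a directed set and $\varphi:B\to\Delta$ is such that for every $\alpha_0\in\Delta$ there is $\beta_0\in B$ with $\varphi(\beta)\ge\alpha_0$ for all $\beta\ge\beta_0$. The same notions are used in $(F,q,W)$ with respect to $q$. The linear operator $T$ is $rp$-compact if for every $p$-bounded net $(x_\alpha)$ in $E$ there are a subnet $(x_{\varphi(\beta)})_{\beta\in B}$ and an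 element $y\in F$ such that $(Tx_{\varphi(\beta)})_{\beta\in B}$ is relatively uniformly $q$-convergent to $y$ in $(F,q,W)$, i.e. there is $w\in W_+$ such that for every real $\varepsilon>0$ there is $\beta_\varepsilon\in B$ with $q(Tx_{\varphi(\beta)}-y)\le\varepsilon w$ for all $\beta\ge\beta_\varepsilon$. The operator $T$ is $p$-bounded if it maps every $p$-bounded subset of $E$ to a $q$-bounded subset of $F$. *)

theory Defs
  imports Complex_Main
begin

class archimedean_vector_lattice = ordered_real_vector + lattice +
  assumes archimedean: "0 \<le> x \<Longrightarrow> 0 \<le> y \<Longrightarrow> (\<And>n::nat. real n *\<^sub>R x \<le> y) \<Longrightarrow> x = 0"

definition lattice_normed_space ::
  "('e::real_vector \<Rightarrow> 'v::archimedean_vector_lattice) \<Rightarrow> bool" where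
  "lattice_normed_space p \<longleftrightarrow>
     (\<forall>x. 0 \<le> p x) \<and>
     (\<forall>x. p x = 0 \<longleftrightarrow> x = 0) \<and>
     (\<forall>x y. p (x + y) \<le> p x + p y) \<and>
     (\<forall>c x. p (c *\<^sub>R x) = \<bar>c\<bar> *\<^sub>R p x)"

definition p_bounded_set ::
  "('e::real_vector \<Rightarrow> 'v::archimedean_vector_lattice) \<Rightarrow> 'e set \<Rightarrow> bool" where
  "p_bounded_set p M \<longleftrightarrow> (\<exists>e\<ge>0. p ` M \<subseteq> {-e..e})"

definition p_bounded_operator ::
  "('e::real_vector \<Rightarrow> 'v::archimedean_vector_lattice) \<Rightarrow>
   ('f::real_vector \<Rightarrow> 'w::archimedean_vector_lattice) \<Rightarrow> ('e \<Rightarrow> 'f) \<Rightarrow> bool" where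
  "p_bounded_operator p q T \<longleftrightarrow> (\<forall>M. p_bounded_set p M \<longrightarrow> p_bounded_set q (T ` M))"

text \<open>
  A net is given by a directed preorder \<open>r\<close> on a carrier set \<open>D\<close>, where \<open>(a, b) \<in> r\<close> means
  \<open>a \<le> b\<close>, and a function whose values outside \<open>D\<close> are irrelevant.
\<close>

definition directed_set :: "'i set \<Rightarrow> ('i \<times> 'i) set \<Rightarrow> bool" where
  "directed_set D r \<longleftrightarrow>
     D \<noteq> {} \<and> preorder_on D r \<and> (\<forall>a\<in>D. \<forall>b\<in>D. \<exists>c\<in>D. (a, c) \<in> r \<and> (b, c) \<in> r)"

definition rp_convergent ::
  "('e::real_vector \<Rightarrow> 'v::archimedean_vector_lattice) \<Rightarrow>
   'i set \<Rightarrow> ('i \<times> 'i) set \<Rightarrow> ('i \<Rightarrow> 'e) \<Rightarrow> 'e \<Rightarrow> bool" where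
  "rp_convergent p D r x l \<longleftrightarrow>
     (\<exists>e\<ge>0. \<forall>\<epsilon>::real. \<epsilon> > 0 \<longrightarrow>
        (\<exists>a\<in>D. \<forall>b\<in>D. (a, b) \<in> r \<longrightarrow> p (x b - l) \<le> \<epsilon> *\<^sub>R e))"

definition subnet_map ::
  "'i set \<Rightarrow> ('i \<times> 'i) set \<Rightarrow> 'j set \<Rightarrow> ('j \<times> 'j) set \<Rightarrow> ('j \<Rightarrow> 'i) \<Rightarrow> bool" where
  "subnet_map D r B s \<phi> \<longleftrightarrow>
     directed_set B s \<and> \<phi> ` B \<subseteq> D \<and>
     (\<forall>a\<in>D. \<exists>b\<in>B. \<forall>b'\<in>B. (b, b') \<in> s \<longrightarrow> (a, \<phi> b') \<in> r)"

text \<open>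
  A definition cannot quantify over index types. The two types used below are large enough to
  make this harmless: a net in \<open>'e\<close> may be replaced by the canonical net of its filter of tails,
  indexed by pairs (point of a tail, tail), and a convergent subnet of a net indexed by \<open>'i\<close> may
  be replaced by one indexed by \<open>'i \<times> nat\<close>. The lemmas \<open>rp_compact_every_index_type\<close> and
  \<open>rp_compactI_every_index_type\<close> state this independence.
\<close>

definition rp_compact ::
  "('e::real_vector \<Rightarrow> 'v::archimedean_vector_lattice) \<Rightarrow>
   ('f::real_vector \<Rightarrow> 'w::archimedean_vector_lattice) \<Rightarrow> ('e \<Rightarrow> 'f) \<Rightarrow> bool" where
  "rp_compact p q T \<longleftrightarrow>
     (\<forall>(D :: ('e \<times> 'e set) set) r x.
        directed_set D r \<and> p_bounded_set p (x ` D) \<longrightarrow>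
        (\<exists>(B :: (('e \<times> 'e set) \<times> nat) set) s \<phi> y.
           subnet_map D r B s \<phi> \<and> rp_convergent q B s (\<lambda>b. T (x (\<phi> b))) y))"

lemma rp_convergent_subnet_imp_cluster:
  assumes "directed_set D r" "subnet_map D r B s \<phi>" "rp_convergent q B s (\<lambda>b. z (\<phi> b)) y"
  shows "\<exists>w\<ge>0. \<forall>\<epsilon>>0. \<forall>a\<in>D. \<exists>c\<in>D. (a, c) \<in> r \<and> q (z c - y) \<le> \<epsilon> *\<^sub>R w"
proof -
  from assms(3) obtain w where w: "w \<ge> 0"
    and conv: "\<And>\<epsilon>::real. \<epsilon> > 0 \<Longrightarrow>
      \<exists>a\<in>B. \<forall>b\<in>B. (a, b) \<in> s \<longrightarrow> q (z (\<phi> b) - y) \<le> \<epsilon> *\<^sub>R w"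
    unfolding rp_convergent_def by blast
  have "\<exists>c\<in>D. (a, c) \<in> r \<and> q (z c - y) \<le> \<epsilon> *\<^sub>R w" if eps: "\<epsilon> > 0" and a: "a \<in> D" for \<epsilon> :: real and a
  proof -
    have dirB: "directed_set B s"
      using assms(2) unfolding subnet_map_def by blast
    obtain b1 where b1: "b1 \<in> B"
      and close: "\<And>b. b \<in> B \<Longrightarrow> (b1, b) \<in> s \<Longrightarrow> q (z (\<phi> b) - y) \<le> \<epsilon> *\<^sub>R w"
      using conv[OF eps] by blast
    obtain b2 where b2: "b2 \<in> B" and above: "\<And>b. b \<in> B \<Longrightarrow> (b2, b) \<in> s \<Longrightarrow> (a, \<phi> b) \<in> r"
    proof -
      have "\<exists>b\<in>B. \<forall>b'\<in>B. (b, b') \<in> s \<longrightarrow> (a, \<phi> b') \<in> r"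
        using assms(2) a by (simp add: subnet_map_def)
      then show ?thesis
        using that by (elim bexE) simp
    qed
    obtain b where b: "b \<in> B" "(b1, b) \<in> s" "(b2, b) \<in> s"
      using dirB b1 b2 unfolding directed_set_def by blast
    have "\<phi> b \<in> D"
      using assms(2) b(1) by (auto simp: subnet_map_def)
    then show ?thesis
      using above[OF b(1,3)] close[OF b(1,2)] by (intro bexI[of _ "\<phi> b"] conjI)
  qed
  then show ?thesis
    using w by blast
qed

lemma cluster_imp_rp_convergent_subnet:
  fixes D :: "'i set" and q :: "'f::real_vector \<Rightarrow> 'w::archimedean_vector_lattice"
  assumes dir: "directed_set D r" and w: "w \<ge> 0"
    and cluster: "\<forall>\<epsilon>>0. \<forall>a\<in>D. \<exists>c\<in>D. (a, c) \<in> r \<and> q (z c - y) \<le> \<epsilon> *\<^sub>R w"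
  shows "\<exists>(B :: ('i \<times> nat) set) s \<phi>.
           subnet_map D r B s \<phi> \<and> rp_convergent q B s (\<lambda>b. z (\<phi> b)) y"
proof -
  define B where "B = {(a, n :: nat). a \<in> D \<and> q (z a - y) \<le> inverse (real (Suc n)) *\<^sub>R w}"
  define s where "s = {(b, b'). b \<in> B \<and> b' \<in> B \<and> (fst b, fst b') \<in> r \<and> snd b \<le> snd b'}"
  have r_refl: "(a, a) \<in> r" if "a \<in> D" for a
    using dir that by (simp add: directed_set_def preorder_on_def refl_on_def)
  have "trans r"
    using dir by (simp add: directed_set_def preorder_on_def)
  then have r_trans: "(a, c) \<in> r" if "(a, b) \<in> r" "(b, c) \<in> r" for a b c
    using that by (rule transD)
  have cofinal: "\<exists>c. (c, n) \<in> B \<and> (a, c) \<in> r" if "a \<in> D" for a n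
  proof -
    have "inverse (real (Suc n)) > 0" by simp
    then show ?thesis
      using cluster that unfolding B_def by blast
  qed
  have pre: "preorder_on B s"
    unfolding preorder_on_def
  proof (intro conjI)
    show "s \<subseteq> B \<times> B" by (auto simp: s_def)
    show "refl_on B s" by (auto simp: refl_on_def s_def B_def r_refl)
    show "trans s"
    proof (rule transI)
      fix u v t assume "(u, v) \<in> s" "(v, t) \<in> s"
      then show "(u, t) \<in> s"
        using r_trans[of "fst u" "fst v" "fst t"] by (simp add: s_def)
    qed
  qed
  have dirB: "directed_set B s"
    unfolding directed_set_def
  proof (intro conjI ballI)
    show "B \<noteq> {}" using dir cofinal unfolding directed_set_def by blast
    show "preorder_on B s" by (rule pre)
    fix b1 b2 assume b: "b1 \<in> B" "b2 \<in> B"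
    then have "fst b1 \<in> D" "fst b2 \<in> D" by (auto simp: B_def)
    then obtain a where a: "a \<in> D" "(fst b1, a) \<in> r" "(fst b2, a) \<in> r"
      using dir unfolding directed_set_def by blast
    obtain c where c: "(c, max (snd b1) (snd b2)) \<in> B" "(a, c) \<in> r"
      using cofinal[OF a(1)] by blast
    show "\<exists>c\<in>B. (b1, c) \<in> s \<and> (b2, c) \<in> s"
      by (rule bexI[OF _ c(1)]) (use b c r_trans[OF a(2) c(2)] r_trans[OF a(3) c(2)] in \<open>simp add: s_def\<close>)
  qed
  have "subnet_map D r B s fst"
    unfolding subnet_map_def
  proof (intro conjI ballI)
    show "directed_set B s" by (rule dirB)
    show "fst ` B \<subseteq> D" by (auto simp: B_def)
    fix a assume "a \<in> D"
    then obtain c where c: "(c, 0) \<in> B" "(a, c) \<in> r"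
      using cofinal by blast
    show "\<exists>b\<in>B. \<forall>b'\<in>B. (b, b') \<in> s \<longrightarrow> (a, fst b') \<in> r"
      by (rule bexI[OF _ c(1)]) (use r_trans[OF c(2)] in \<open>auto simp: s_def\<close>)
  qed
  moreover have "rp_convergent q B s (\<lambda>b. z (fst b)) y"
    unfolding rp_convergent_def
  proof (intro exI[of _ w] conjI allI impI)
    show "w \<ge> 0" by (rule w)
    fix \<epsilon> :: real assume "\<epsilon> > 0"
    then obtain n where n: "inverse (real (Suc n)) < \<epsilon>"
      using reals_Archimedean by blast
    obtain a where "a \<in> D" using dir unfolding directed_set_def by blast
    then obtain c where c: "(c, n) \<in> B" using cofinal by blast
    have "q (z (fst b) - y) \<le> \<epsilon> *\<^sub>R w" if "b \<in> B" "((c, n), b) \<in> s" for b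
    proof -
      have "n \<le> snd b" using that(2) by (auto simp: s_def)
      then have "inverse (real (Suc (snd b))) \<le> inverse (real (Suc n))"
        by (intro le_imp_inverse_le) auto
      then have "inverse (real (Suc (snd b))) *\<^sub>R w \<le> \<epsilon> *\<^sub>R w"
        using n w by (intro scaleR_right_mono) linarith+
      moreover have "q (z (fst b) - y) \<le> inverse (real (Suc (snd b))) *\<^sub>R w"
        using that(1) by (auto simp: B_def)
      ultimately show ?thesis by order
    qed
    then show "\<exists>a\<in>B. \<forall>b\<in>B. (a, b) \<in> s \<longrightarrow> q (z (fst b) - y) \<le> \<epsilon> *\<^sub>R w"
      using c by blast
  qed
  ultimately show ?thesis by blast
qed

lemma rp_compact_every_index_type:
  fixes D :: "'i set" and p :: "'e::real_vector \<Rightarrow> 'v::archimedean_vector_lattice"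
    and q :: "'f::real_vector \<Rightarrow> 'w::archimedean_vector_lattice"
  assumes "rp_compact p q T" and dir: "directed_set D r" and bdd: "p_bounded_set p (x ` D)"
  shows "\<exists>(B :: ('i \<times> nat) set) s \<phi> y.
           subnet_map D r B s \<phi> \<and> rp_convergent q B s (\<lambda>b. T (x (\<phi> b))) y"
proof -
  define tail where "tail a = x ` {b \<in> D. (a, b) \<in> r}" for a
  define D' where "D' = {(u, S). \<exists>a\<in>D. S = tail a \<and> u \<in> S}"
  define r' where "r' = {(d, d'). d \<in> D' \<and> d' \<in> D' \<and> snd d' \<subseteq> snd d}"
  have r_refl: "(a, a) \<in> r" if "a \<in> D" for a
    using dir that by (simp add: directed_set_def preorder_on_def refl_on_def)
  have "trans r"
    using dir by (simp add: directed_set_def preorder_on_def)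
  then have r_trans: "(a, c) \<in> r" if "(a, b) \<in> r" "(b, c) \<in> r" for a b c
    using that by (rule transD)
  have in_D': "(x a, tail a) \<in> D'" if "a \<in> D" for a
    using that r_refl by (auto simp: D'_def tail_def)
  have tail_mono: "tail c \<subseteq> tail a" if "(a, c) \<in> r" for a c
    using r_trans[OF that] by (auto simp: tail_def)
  have pre: "preorder_on D' r'"
    unfolding preorder_on_def
  proof (intro conjI)
    show "r' \<subseteq> D' \<times> D'" by (auto simp: r'_def)
    show "refl_on D' r'" by (auto simp: refl_on_def r'_def)
    show "trans r'" by (rule transI) (auto simp: r'_def)
  qed
  have dir': "directed_set D' r'"
    unfolding directed_set_def
  proof (intro conjI ballI)
    show "D' \<noteq> {}" using dir in_D' unfolding directed_set_def by blast
    show "preorder_on D' r'" by (rule pre)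
    fix d1 d2 assume d: "d1 \<in> D'" "d2 \<in> D'"
    then obtain a1 a2 where a: "a1 \<in> D" "snd d1 = tail a1" "a2 \<in> D" "snd d2 = tail a2"
      by (auto simp: D'_def)
    then obtain c where c: "c \<in> D" "(a1, c) \<in> r" "(a2, c) \<in> r"
      using dir unfolding directed_set_def by blast
    show "\<exists>c\<in>D'. (d1, c) \<in> r' \<and> (d2, c) \<in> r'"
      by (rule bexI[OF _ in_D'[OF c(1)]])
        (use a d c in_D'[OF c(1)] tail_mono[OF c(2)] tail_mono[OF c(3)] in \<open>simp add: r'_def\<close>)
  qed
  have "fst ` D' \<subseteq> x ` D" by (auto simp: D'_def tail_def)
  then have "p_bounded_set p (fst ` D')"
    using bdd unfolding p_bounded_set_def by (meson image_mono order_trans)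
  then obtain B :: "(('e \<times> 'e set) \<times> nat) set" and s \<phi> y
    where "subnet_map D' r' B s \<phi>" "rp_convergent q B s (\<lambda>b. T (fst (\<phi> b))) y"
    using assms(1) dir' unfolding rp_compact_def by blast
  then obtain w where w: "w \<ge> 0" and cluster:
    "\<forall>\<epsilon>>0. \<forall>d\<in>D'. \<exists>c\<in>D'. (d, c) \<in> r' \<and> q (T (fst c) - y) \<le> \<epsilon> *\<^sub>R w"
    using rp_convergent_subnet_imp_cluster[OF dir', of B s \<phi> q "\<lambda>d. T (fst d)" y] by blast
  have "\<exists>c\<in>D. (a, c) \<in> r \<and> q (T (x c) - y) \<le> \<epsilon> *\<^sub>R w" if eps: "\<epsilon> > 0" and a: "a \<in> D" for \<epsilon> :: real and a
  proof -
    obtain d where d: "d \<in> D'" "((x a, tail a), d) \<in> r'" "q (T (fst d) - y) \<le> \<epsilon> *\<^sub>R w"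
      using cluster eps in_D'[OF a] by blast
    then have "fst d \<in> tail a" by (auto simp: D'_def r'_def)
    then show ?thesis using d(3) by (auto simp: tail_def)
  qed
  then have "\<forall>\<epsilon>>0. \<forall>a\<in>D. \<exists>c\<in>D. (a, c) \<in> r \<and> q (T (x c) - y) \<le> \<epsilon> *\<^sub>R w"
    by blast
  from cluster_imp_rp_convergent_subnet[where z = "\<lambda>a. T (x a)", OF dir w this]
  show ?thesis by blast
qed

lemma rp_compactI_every_index_type:
  fixes p :: "'e::real_vector \<Rightarrow> 'v::archimedean_vector_lattice"
    and q :: "'f::real_vector \<Rightarrow> 'w::archimedean_vector_lattice"
  assumes "\<And>(D :: ('e \<times> 'e set) set) r x.
     directed_set D r \<Longrightarrow> p_bounded_set p (x ` D) \<Longrightarrow>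
     \<exists>(B :: 'j set) s \<phi> y.
       subnet_map D r B s \<phi> \<and> rp_convergent q B s (\<lambda>b. T (x (\<phi> b))) y"
  shows "rp_compact p q T"
  unfolding rp_compact_def
proof (intro allI impI, elim conjE)
  fix D :: "('e \<times> 'e set) set" and r x
  assume dir: "directed_set D r" and "p_bounded_set p (x ` D)"
  then obtain B :: "'j set" and s \<phi> y
    where "subnet_map D r B s \<phi>" "rp_convergent q B s (\<lambda>b. T (x (\<phi> b))) y"
    using assms by blast
  then obtain w where w: "w \<ge> 0" and cluster:
    "\<forall>\<epsilon>>0. \<forall>a\<in>D. \<exists>c\<in>D. (a, c) \<in> r \<and> q (T (x c) - y) \<le> \<epsilon> *\<^sub>R w"
    using rp_convergent_subnet_imp_cluster[OF dir, of B s \<phi> q "\<lambda>a. T (x a)" y] by blast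
  from cluster_imp_rp_convergent_subnet[where z = "\<lambda>a. T (x a)", OF dir w cluster]
  show "\<exists>(B :: (('e \<times> 'e set) \<times> nat) set) s \<phi> y.
          subnet_map D r B s \<phi> \<and> rp_convergent q B s (\<lambda>b. T (x (\<phi> b))) y"
    by blast
qed

end

theory Submission
  imports Defs
begin

text \<open>
  If the image of a \<open>p\<close>-bounded set \<open>M\<close> is not \<open>q\<close>-bounded, choose for each \<open>u\<close> in the positive
  cone of \<open>W\<close> some \<open>x u \<in> M\<close> with \<open>q (T (x u)) \<le> u\<close> false. This is a \<open>p\<close>-bounded net indexed by the
  positive cone. If \<open>T (x \<cdot>)\<close> has a subnet converging to \<open>y\<close> with regulator \<open>w\<close>, then
  \<open>q (T (x u)) \<le> w + q y\<close> for some \<open>u \<ge> w + q y\<close>, contradicting the choice of \<open>x u\<close>.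
\<close>

text \<open>The conjunct \<open>0 \<le> u\<close> keeps the relation inside the carrier, as
  \<open>preorder_on\<close> requires.\<close>

lemma directed_set_nonneg:
  "directed_set {0::'w::archimedean_vector_lattice..} {(u, v). 0 \<le> u \<and> u \<le> v}"
  unfolding directed_set_def preorder_on_def
proof (intro conjI ballI)
  show "trans {(u::'w, v). 0 \<le> u \<and> u \<le> v}"
    by (rule transI) auto
  fix a b :: 'w
  assume "a \<in> {0..}" "b \<in> {0..}"
  then show "\<exists>c\<in>{0..}. (a, c) \<in> {(u, v). 0 \<le> u \<and> u \<le> v} \<and> (b, c) \<in> {(u, v). 0 \<le> u \<and> u \<le> v}"
    by (intro bexI[of _ "a + b"]) auto
qed (auto simp: refl_on_def)

text \<open>The lower bound is automatic: \<open>- e \<le> 0 \<le> p x\<close>.\<close>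

lemma p_bounded_set_iff:
  assumes "lattice_normed_space p"
  shows "p_bounded_set p M \<longleftrightarrow> (\<exists>e\<ge>0. \<forall>x\<in>M. p x \<le> e)"
proof -
  have "- e \<le> p x" if "0 \<le> e" for e x
  proof -
    have "- e \<le> 0" using that by simp
    also have "0 \<le> p x" using assms by (simp add: lattice_normed_space_def)
    finally show ?thesis .
  qed
  then show ?thesis
    by (auto simp: p_bounded_set_def image_subset_iff)
qed

theorem theorem11:
  fixes p :: "'e::real_vector \<Rightarrow> 'v::archimedean_vector_lattice"
    and q :: "'f::real_vector \<Rightarrow> 'w::archimedean_vector_lattice"
    and T :: "'e \<Rightarrow> 'f"
  assumes "lattice_normed_space p"
    and "lattice_normed_space q"
    and "linear T"
    and "rp_compact p q T"
  shows "p_bounded_operator p q T"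
  unfolding p_bounded_operator_def
proof (intro allI impI, rule ccontr)
  fix M
  assume M: "p_bounded_set p M" and "\<not> p_bounded_set q (T ` M)"
  then have "\<forall>u\<in>{0..}. \<exists>m\<in>M. \<not> q (T m) \<le> u"
    by (auto simp: p_bounded_set_iff[OF assms(2)])
  then obtain x where x: "\<forall>u\<in>{0..}. x u \<in> M \<and> \<not> q (T (x u)) \<le> u"
    by metis
  let ?r = "{(u::'w, v). 0 \<le> u \<and> u \<le> v}"
  have "p_bounded_set p (x ` {0..})"
    using M x by (fastforce simp: p_bounded_set_iff[OF assms(1)])
  \<comment> \<open>The net is indexed by elements of W, so \<open>rp_compact\<close> applies only
    after a change of index type.\<close>
  then obtain B :: "('w \<times> nat) set" and s \<phi> y where
    "subnet_map {0..} ?r B s \<phi>" "rp_convergent q B s (\<lambda>b. T (x (\<phi> b))) y"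
    using rp_compact_every_index_type[OF assms(4) directed_set_nonneg] by blast
  then obtain w where w: "w \<ge> 0" and cluster:
    "\<forall>\<epsilon>>0. \<forall>a\<in>{0..}. \<exists>c\<in>{0..}. (a, c) \<in> ?r \<and> q (T (x c) - y) \<le> \<epsilon> *\<^sub>R w"
    using rp_convergent_subnet_imp_cluster[OF directed_set_nonneg, of B s \<phi> q "\<lambda>u. T (x u)" y]
    by blast
  have q_nonneg: "0 \<le> q y" and q_add: "q (a + b) \<le> q a + q b" for a b
    using assms(2) by (simp_all add: lattice_normed_space_def)
  \<comment> \<open>This index is the bound that the triangle inequality gives for
    \<open>q (T (x c))\<close> when \<epsilon> = 1.\<close>
  have "w + q y \<in> {0..}"
    using w q_nonneg by simp
  then obtain c where c: "c \<in> {0..}" "(w + q y, c) \<in> ?r" "q (T (x c) - y) \<le> 1 *\<^sub>R w"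
    using cluster zero_less_one by blast
  have "q (T (x c)) \<le> q (T (x c) - y) + q y"
    using q_add[of "T (x c) - y" y] by simp
  also have "\<dots> \<le> w + q y"
    using c(3) by simp
  also have "\<dots> \<le> c"
    using c(2) by simp
  finally show False
    using x c(1) by blast
qed

end
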